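(* There exist a $\sigma$-finite measure space $(\Omega,\mathcal{B},\mu)$ with $\mu(\Omega)=\infty$, a conservative, invertible, measure-preserving, ergodic transformation $T:\Omega\to\Omega$, and a $\mathcal{B}$-measurable function $f:\Omega\to\{0,1\}$ such that, for all $\omega\in\Omega$, $$\limsup_{n\to+\infty}A_n(\omega,f,T)=1\quad\text{while}\quad \lim_{n\to+\infty}A_n(\omega,f,T^{-1})=0.$$
   Context: For a measurable $T:\Omega\to\Omega$, a measurable $f:\Omega\to\mathbb{R}$ and $n\in\mathbb{N}=\{1,2,\dots\}$, $A_n(\omega,f,T)=\frac1n\sum_{k=0}^{n-1}f(T^k\omega)$. A measurable transformation $T$ is: invertible if it is bijective and $T^{-1}$ is measurable; measure-preserving if $\mu(T^{-1}E)=\mu(E)$ for all $E\in\mathcal{B}$; ergodic if $T^{-1}E=E$ (with $E\in\mathcal{B}$) implies $\mu(E)=0$ or $\mu(\Omega\setminus E)=0$; conservative if there is no $W\in\mathcal{B}$ with $\mu(W)>0$ such that the sets $T^{-n}W$, $n\ge 0$, are pairwise disjoint. *)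

theory Defs
  imports "HOL-Analysis.Analysis"
begin

(* The underlying set is space M, which need not be the whole type, so preimages are
   intersected with space M and inverses are taken relative to space M. *)

definition birkhoff_avg :: "nat \<Rightarrow> 'a \<Rightarrow> ('a \<Rightarrow> real) \<Rightarrow> ('a \<Rightarrow> 'a) \<Rightarrow> real" where
  "birkhoff_avg n \<omega> f T = (1 / real n) * (\<Sum>k<n. f ((T ^^ k) \<omega>))"

definition inverse_map :: "'a measure \<Rightarrow> ('a \<Rightarrow> 'a) \<Rightarrow> 'a \<Rightarrow> 'a" where
  "inverse_map M T = the_inv_into (space M) T"

definition invertible_map :: "'a measure \<Rightarrow> ('a \<Rightarrow> 'a) \<Rightarrow> bool" where
  "invertible_map M T \<longleftrightarrow>
     bij_betw T (space M) (space M) \<and> inverse_map M T \<in> M \<rightarrow>\<^sub>M M"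

definition measure_preserving_map :: "'a measure \<Rightarrow> ('a \<Rightarrow> 'a) \<Rightarrow> bool" where
  "measure_preserving_map M T \<longleftrightarrow>
     (\<forall>E\<in>sets M. emeasure M (T -` E \<inter> space M) = emeasure M E)"

definition ergodic_map :: "'a measure \<Rightarrow> ('a \<Rightarrow> 'a) \<Rightarrow> bool" where
  "ergodic_map M T \<longleftrightarrow>
     (\<forall>E\<in>sets M. T -` E \<inter> space M = E \<longrightarrow>
        emeasure M E = 0 \<or> emeasure M (space M - E) = 0)"

definition conservative_map :: "'a measure \<Rightarrow> ('a \<Rightarrow> 'a) \<Rightarrow> bool" where
  "conservative_map M T \<longleftrightarrow>
     \<not> (\<exists>W\<in>sets M. emeasure M W > 0 \<and>
          disjoint_family (\<lambda>n. (T ^^ n) -` W \<inter> space M))"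

end

theory Submission
  imports Defs "HOL-Real_Asymp.Real_Asymp"
begin

text \<open>
  The transformation is a Kakutani tower over the dyadic odometer on the irrationals of (0,1). The
  column over \<open>y\<close> is determined by the number \<open>j\<close> of leading binary ones of \<open>y\<close>: it has
  \<open>2^(j^2)\<close> bottom levels, on which \<open>f = 1\<close>, below \<open>j * 2^(j^2)\<close> levels on which \<open>f = 0\<close>.

  The odometer meets \<open>{lead \<ge> j}\<close> within any \<open>2^j\<close> consecutive steps. Moving up,
  the first column with \<open>lead \<ge> j\<close> starts with a run of ones that is much longer than
  everything before it, since \<open>2^(j^2)\<close> outgrows \<open>2^j\<close> columns of smaller height. Moving down, each
  column shows its zeros before its ones, so columns with \<open>lead \<ge> j\<close> contribute at most a
  fraction \<open>1/(j+1)\<close> of ones, and the at most \<open>2^j\<close> lower columns between two of them are absorbed by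
  their length.

  Orbits are dense enough to contain all dyadic translates of a base point, which gives both ergodicity
  and conservativity.
\<close>

section \<open>The dyadic odometer\<close>

text \<open>On [0,1), \<open>lead x\<close> is the number of leading binary ones of \<open>x\<close>.\<close>

definition lead :: "real \<Rightarrow> nat" where
  "lead x = (LEAST j. x < 1 - (1/2)^Suc j)"

text \<open>Adding one with carry to the right: \<open>0.1...10z\<close> becomes \<open>0.0...01z\<close>.\<close>

definition odo :: "real \<Rightarrow> real" where
  "odo x = x - 1 + 3 * (1/2)^Suc (lead x)"

text \<open>The map \<open>x \<mapsto> 1 - odo x\<close> is an involution preserving \<open>lead\<close>: it reflects each set
  \<open>{lead = j}\<close>. Hence this conjugate of \<open>odo\<close> is its inverse.\<close>

definition odo_inv :: "real \<Rightarrow> real" where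
  "odo_inv x = 1 - odo (1 - x)"

text \<open>All rationals are discarded, not only the dyadic endpoints of the sets
  \<open>{lead = j}\<close>: the rational displacements of \<open>odo\<close> then keep points
  irrational, and only a null set is lost.\<close>

definition irr :: "real set" where
  "irr = {0<..<1} - \<rat>"

lemma irrD: "x \<in> irr \<Longrightarrow> 0 < x" "x \<in> irr \<Longrightarrow> x < 1" "x \<in> irr \<Longrightarrow> x \<notin> \<rat>"
  by (auto simp: irr_def)

lemma add_Rats_iff: "q \<in> \<rat> \<Longrightarrow> x + q \<in> \<rat> \<longleftrightarrow> x \<in> (\<rat> :: real set)"
  by (metis Rats_add Rats_diff add_diff_cancel_right')

lemma irr_compl: "x \<in> irr \<Longrightarrow> 1 - x \<in> irr"
  using Rats_diff[of 1 "1 - x"] by (auto simp: irr_def)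

lemma irr_half: "x \<in> irr \<Longrightarrow> x / 2 \<in> irr"
  using Rats_mult[of 2 "x/2"] by (auto simp: irr_def)

lemma irr_double: "x \<in> irr \<Longrightarrow> x < 1/2 \<Longrightarrow> 2 * x \<in> irr"
  using Rats_divide[of "2*x" 2] by (auto simp: irr_def)

lemma irr_double': "x \<in> irr \<Longrightarrow> \<not> x < 1/2 \<Longrightarrow> 2 * x - 1 \<in> irr"
  using Rats_divide[of "2*x" 2] Rats_add[of "2*x - 1" 1] by (cases "x = 1/2") (auto simp: irr_def)

lemma ex_less_one_minus_half_power:
  assumes "x < (1::real)" shows "\<exists>j. x < 1 - (1/2)^Suc j"
proof -
  obtain n where "(1/2::real)^n < 1 - x"
    using real_arch_pow_inv[of "1-x" "1/2"] assms by auto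
  moreover have "(1/2::real)^Suc n \<le> (1/2)^n" by simp
  ultimately have "x < 1 - (1/2)^Suc n" by linarith
  then show ?thesis by blast
qed

lemma lead_upper: "x < 1 \<Longrightarrow> x < 1 - (1/2)^Suc (lead x)"
  unfolding lead_def by (rule LeastI_ex) (rule ex_less_one_minus_half_power)

lemma lead_lower:
  assumes "0 \<le> x" shows "1 - (1/2)^lead x \<le> x"
proof (cases "lead x")
  case 0 then show ?thesis using assms by simp
next
  case (Suc j)
  then have "\<not> x < 1 - (1/2)^Suc j" unfolding lead_def by (metis lessI not_less_Least)
  then show ?thesis using Suc by simp
qed

lemma lead_eqI:
  assumes "1 - (1/2)^j \<le> x" "x < 1 - (1/2)^Suc j" shows "lead x = j"
  unfolding lead_def
proof (rule Least_equality)
  fix i assume i: "x < 1 - (1/2)^Suc i"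
  show "j \<le> i"
  proof (rule ccontr)
    assume "\<not> j \<le> i"
    then have "(1/2::real)^j \<le> (1/2)^Suc i" by (intro power_decreasing) auto
    with i assms show False by linarith
  qed
qed fact

lemma lead_small: "0 \<le> x \<Longrightarrow> x < 1/2 \<Longrightarrow> lead x = 0"
  by (rule lead_eqI) auto

text \<open>Passing from x to (1 + x) / 2 prepends a binary one, just as x / 2 prepends a
  zero.\<close>

lemma lead_Suc:
  assumes "0 \<le> x" "x < 1" shows "lead ((1 + x) / 2) = Suc (lead x)"
  using lead_lower[OF assms(1)] lead_upper[OF assms(2)]
  by (intro lead_eqI) (auto simp: field_simps)

lemma odo_small: "0 \<le> x \<Longrightarrow> x < 1/2 \<Longrightarrow> odo x = x + 1/2"
  by (simp add: odo_def lead_small)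

text \<open>Adding one to a leading one turns it into a zero and carries, so the odometer acts on
  the remaining digits.\<close>

lemma odo_half': "0 \<le> x \<Longrightarrow> x < 1 \<Longrightarrow> odo ((1 + x) / 2) = odo x / 2"
  by (simp add: odo_def lead_Suc field_simps)

lemma odo_diff_Rats: "odo x - x \<in> \<rat>"
proof -
  have "odo x - x = 3 * (1/2)^Suc (lead x) - 1" by (simp add: odo_def)
  also have "\<dots> \<in> \<rat>" by (intro Rats_diff Rats_mult Rats_power) auto
  finally show ?thesis .
qed

lemma irr_one_sub_odo:
  assumes x: "x \<in> irr" shows "1 - odo x \<in> irr" "lead (1 - odo x) = lead x"
proof -
  let ?j = "lead x"
  \<comment> \<open>Irrationality makes this bound strict. The reflection swaps the endpoints, and
    \<open>lead_eqI\<close> wants a strict upper bound.\<close>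
  have low: "1 - (1/2)^?j < x"
  proof -
    have "1 - (1/2)^?j \<in> (\<rat>::real set)" by (intro Rats_diff Rats_power) auto
    then have "1 - (1/2)^?j \<noteq> x" using irrD(3)[OF x] by metis
    then show ?thesis using lead_lower[of x] irrD(1)[OF x] by linarith
  qed
  have up: "x < 1 - (1/2)^Suc ?j" by (rule lead_upper) (use irrD[OF x] in auto)
  have b: "1 - (1/2)^?j < 1 - odo x" "1 - odo x < 1 - (1/2)^Suc ?j"
    using low up by (auto simp: odo_def)
  show "lead (1 - odo x) = lead x" using b by (intro lead_eqI) auto
  have "odo x \<notin> \<rat>"
    using irrD(3)[OF x] add_Rats_iff[OF odo_diff_Rats[of x], of x] by simp
  then have "1 - odo x \<notin> \<rat>" by (metis Rats_1 Rats_diff diff_diff_eq2 add_diff_cancel_left')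
  moreover have "(1/2::real)^?j \<le> 1" by (simp add: power_le_one)
  moreover have "(1/2::real)^Suc ?j > 0" by simp
  ultimately show "1 - odo x \<in> irr" using b unfolding irr_def by simp
qed

lemma odo_irr: "x \<in> irr \<Longrightarrow> odo x \<in> irr"
  using irr_compl[OF irr_one_sub_odo(1)[of x]] by simp

lemma odo_inv_irr: "x \<in> irr \<Longrightarrow> odo_inv x \<in> irr"
  unfolding odo_inv_def by (intro irr_one_sub_odo irr_compl)

lemma odo_inv_odo: "x \<in> irr \<Longrightarrow> odo_inv (odo x) = x"
  unfolding odo_inv_def odo_def[of "1 - odo x"] by (simp add: irr_one_sub_odo(2)) (simp add: odo_def)

lemma odo_odo_inv: "x \<in> irr \<Longrightarrow> odo (odo_inv x) = x"
  unfolding odo_inv_def odo_def[of "1 - odo (1-x)"]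
  by (simp add: irr_one_sub_odo(2) irr_compl) (simp add: odo_def)

lemma odo_pow_irr: "x \<in> irr \<Longrightarrow> (odo ^^ k) x \<in> irr"
  by (induction k) (auto simp: odo_irr)

lemma odo_inv_pow_irr: "x \<in> irr \<Longrightarrow> (odo_inv ^^ k) x \<in> irr"
  by (induction k) (auto simp: odo_inv_irr)

lemma odo_pow_odo_inv_pow: "x \<in> irr \<Longrightarrow> (odo ^^ k) ((odo_inv ^^ (k + l)) x) = (odo_inv ^^ l) x"
proof (induction k)
  case (Suc k)
  then show ?case by (simp add: funpow_swap1[of odo] odo_odo_inv odo_inv_pow_irr)
qed simp

text \<open>The first digit alternates, so two steps make exactly one carry into the remaining
  digits.\<close>

lemma odo_pow_half:
  assumes "x \<in> irr"
  shows "(odo ^^ (2 * m)) (x / 2) = (odo ^^ m) x / 2"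
    and "(odo ^^ (2 * m)) ((1 + x) / 2) = (1 + (odo ^^ m) x) / 2"
proof -
  have twice: "odo (odo (u / 2)) = odo u / 2" "odo (odo ((1 + u) / 2)) = (1 + odo u) / 2" if "u \<in> irr" for u
  proof -
    have "odo (u / 2) = (1 + u) / 2" using irrD[OF that] odo_small[of "u / 2"] by (simp add: field_simps)
    then show "odo (odo (u / 2)) = odo u / 2" using odo_half'[of u] irrD[OF that] by (simp only:)
    have "odo ((1 + u) / 2) = odo u / 2" using irrD[OF that] by (simp add: odo_half')
    moreover have "odo (odo u / 2) = (1 + odo u) / 2"
      using irrD[OF odo_irr[OF that]] odo_small[of "odo u / 2"] by (simp add: add_divide_distrib)
    ultimately show "odo (odo ((1 + u) / 2)) = (1 + odo u) / 2" by (simp only:)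
  qed
  show "(odo ^^ (2 * m)) (x / 2) = (odo ^^ m) x / 2"
  proof (induction m)
    case (Suc m)
    have "(odo ^^ (2 * Suc m)) (x / 2) = odo (odo ((odo ^^ (2 * m)) (x / 2)))" by simp
    also have "\<dots> = odo ((odo ^^ m) x) / 2" unfolding Suc by (rule twice(1)[OF odo_pow_irr[OF assms]])
    finally show ?case by simp
  qed simp
  show "(odo ^^ (2 * m)) ((1 + x) / 2) = (1 + (odo ^^ m) x) / 2"
  proof (induction m)
    case (Suc m)
    have "(odo ^^ (2 * Suc m)) ((1 + x) / 2) = odo (odo ((odo ^^ (2 * m)) ((1 + x) / 2)))" by simp
    also have "\<dots> = (1 + odo ((odo ^^ m) x)) / 2" unfolding Suc by (rule twice(2)[OF odo_pow_irr[OF assms]])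
    finally show ?case by simp
  qed simp
qed

text \<open>Induction by halving: even times drive \<open>2 * x\<close> through its translates of
  rank n, which gives the translates of x in the lower half. One more step adds 1/2 and gives those
  in the upper half.\<close>

lemma odo_orbit_dyadic:
  assumes "x \<in> irr" "x < 1 / 2^n" "k < 2^n"
  shows "\<exists>m. (odo ^^ m) x = x + real k / 2^n"
  using assms
proof (induction n arbitrary: x k)
  case 0 then show ?case by (intro exI[of _ 0]) auto
next
  case (Suc n)
  have "(1::real) / 2^Suc n \<le> 1/2" by (simp add: field_simps)
  then have "x < 1/2" using Suc.prems by linarith
  then have u: "2 * x \<in> irr" using Suc.prems by (intro irr_double)
  have u2: "2 * x < 1 / 2^n" using Suc.prems by (simp add: field_simps)
  have half: "\<exists>m. (odo ^^ m) x = x + real k' / 2^Suc n \<and> (odo ^^ m) x \<in> irr \<and> (odo ^^ m) x < 1/2" if k': "k' < 2^n" for k'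
  proof -
    obtain m where m: "(odo ^^ m) (2*x) = 2*x + real k' / 2^n" using Suc.IH[OF u u2 k'] by blast
    have e: "(odo ^^ (2*m)) x = (odo ^^ m) (2*x) / 2" using odo_pow_half(1)[OF u, of m] by simp
    have v: "(odo ^^ m) (2*x) \<in> irr" using u by (rule odo_pow_irr)
    have "(odo ^^ (2*m)) x = x + real k' / 2^Suc n" unfolding e using m by (simp add: field_simps)
    moreover have "(odo ^^ (2*m)) x \<in> irr" unfolding e by (rule irr_half[OF v])
    moreover have "(odo ^^ (2*m)) x < 1/2" unfolding e using irrD(2)[OF v] by simp
    ultimately show ?thesis by blast
  qed
  show ?case
  proof (cases "k < 2^n")
    case True then show ?thesis using half by blast
  next
    case False
    define k' where "k' = k - 2^n"
    have k': "k' < 2^n" "k = k' + 2^n" using False Suc.prems unfolding k'_def by auto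
    obtain m where m: "(odo ^^ m) x = x + real k' / 2^Suc n" "(odo ^^ m) x \<in> irr" "(odo ^^ m) x < 1/2" using half[OF k'(1)] by blast
    have "(odo ^^ Suc m) x = x + real k' / 2^Suc n + 1/2" using m irrD[of "(odo ^^ m) x"] by (simp add: odo_small)
    also have "\<dots> = x + real k / 2^Suc n" by (simp add: k' field_simps)
    finally show ?thesis by blast
  qed
qed

text \<open>After at most one step the first digit is one. From there every second step is an
  odometer step on the other digits, where j leading ones appear within 2^j steps.\<close>

lemma odo_orbit_hits_lead:
  assumes "x \<in> irr" shows "\<exists>k<2^j. j \<le> lead ((odo ^^ k) x)"
  using assms
proof (induction j arbitrary: x)
  case (Suc j)
  have *: "\<exists>k<2^j. Suc j \<le> lead ((odo ^^ (2*k)) z)" if z: "z \<in> irr" "\<not> z < 1/2" for z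
  proof -
    have w: "2*z - 1 \<in> irr" using z by (rule irr_double')
    obtain k where k: "k < 2^j" "j \<le> lead ((odo ^^ k) (2*z-1))" using Suc.IH[OF w] by blast
    have "(odo ^^ (2*k)) z = (1 + (odo ^^ k) (2*z-1)) / 2"
      using odo_pow_half(2)[OF w, of k] by simp
    then have "lead ((odo ^^ (2*k)) z) = Suc (lead ((odo ^^ k) (2*z-1)))"
      using odo_pow_irr[OF w, of k] irrD[of "(odo ^^ k) (2*z-1)"] by (simp only:) (simp add: lead_Suc)
    then show ?thesis using k by (intro exI[of _ k]) simp
  qed
  show ?case
  proof (cases "x < 1/2")
    case True
    have "odo x \<in> irr" "\<not> odo x < 1/2"
      using odo_irr[OF Suc.prems] True irrD(1)[OF Suc.prems] odo_small[of x] by auto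
    then obtain k where "k<2^j" "Suc j \<le> lead ((odo ^^ (2*k)) (odo x))" using * by blast
    then show ?thesis by (intro exI[of _ "Suc (2*k)"]) (auto simp: funpow_swap1)
  next
    case False
    then obtain k where "k<2^j" "Suc j \<le> lead ((odo ^^ (2*k)) x)" using * Suc.prems by blast
    then show ?thesis by (intro exI[of _ "2*k"]) auto
  qed
qed simp

lemma odo_inv_orbit_hits_lead:
  assumes x: "x \<in> irr" shows "\<exists>k<2^j. j \<le> lead ((odo_inv ^^ k) x)"
proof -
  \<comment> \<open>Start 2^j - 1 steps in the past: a forward hit from z at time k < 2^j is a
    backward hit from x at time 2^j - 1 - k.\<close>
  define z where "z = (odo_inv ^^ (2^j - 1)) x"
  obtain k where k: "k < 2^j" "j \<le> lead ((odo ^^ k) z)"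
    using odo_orbit_hits_lead[OF odo_inv_pow_irr[OF x]] unfolding z_def by blast
  have "(odo ^^ k) z = (odo_inv ^^ (2^j - 1 - k)) x"
    using odo_pow_odo_inv_pow[OF x, of k "2^j - 1 - k"] k unfolding z_def by simp
  with k show ?thesis by (intro exI[of _ "2^j - 1 - k"]) auto
qed

section \<open>The tower over the odometer\<close>

definition ones :: "nat \<Rightarrow> nat" where "ones j = 2^(j^2)"

definition height :: "nat \<Rightarrow> nat" where "height j = Suc j * ones j"

text \<open>Level \<open>i\<close> of the column over \<open>y\<close> is the real number \<open>y + i\<close>.\<close>

definition tower :: "real set" where
  "tower = {x. 0 \<le> x \<and> x \<notin> \<rat> \<and> nat \<lfloor>x\<rfloor> < height (lead (frac x))}"

definition climb :: "real \<Rightarrow> real" where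
  "climb x = (if Suc (nat \<lfloor>x\<rfloor>) < height (lead (frac x)) then x + 1 else odo (frac x))"

text \<open>On the tower, x < 1 means level 0, where x is its own base point and no
  \<open>frac\<close> is needed. The subtraction of 1 gives the index of the top level of the
  previous column.\<close>

definition climb_inv :: "real \<Rightarrow> real" where
  "climb_inv x = (if 1 \<le> x then x - 1 else odo_inv x + real (height (lead (odo_inv x)) - 1))"

definition bottom :: "real \<Rightarrow> real" where
  "bottom x = (if nat \<lfloor>x\<rfloor> < ones (lead (frac x)) then 1 else 0)"

lemma ones_pos: "0 < ones j"
  by (simp add: ones_def)

lemma ones_le_height: "ones j \<le> height j"
  by (simp add: height_def)

lemma height_pos: "0 < height j"
  using ones_pos[of j] ones_le_height[of j] by simp

lemma ones_mono: "i \<le> j \<Longrightarrow> ones i \<le> ones j"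
  by (simp add: ones_def power_mono)

lemma height_mono: "i \<le> j \<Longrightarrow> height i \<le> height j"
  unfolding height_def by (intro mult_mono ones_mono) auto

text \<open>This ratio is the growth that outweighs up to 2^(j+1) columns with \<open>lead\<close>
  at most j, in both directions of time.\<close>

lemma ones_Suc: "ones (Suc j) = 2 * 4^j * ones j"
proof -
  have "(4::nat)^j = 2^(2*j)" by (simp add: power_mult)
  moreover have "(Suc j)^2 = Suc (2*j) + j^2" by (simp add: power2_eq_square)
  ultimately show ?thesis unfolding ones_def by (simp add: power_add)
qed

lemma irr_add_nat:
  assumes "y \<in> irr"
  shows "frac (y + real i) = y" "nat \<lfloor>y + real i\<rfloor> = i" "y + real i \<notin> \<rat>" "0 \<le> y + real i" "\<lfloor>y\<rfloor> = 0"
proof -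
  have fl: "\<lfloor>y + real i\<rfloor> = int i" using irrD[OF assms] by (simp add: floor_eq_iff)
  then show "frac (y + real i) = y" "nat \<lfloor>y + real i\<rfloor> = i" by (auto simp: frac_def)
  show "y + real i \<notin> \<rat>" using irrD(3)[OF assms] by (simp add: add_Rats_iff)
  show "0 \<le> y + real i" using irrD[OF assms] by simp
  show "\<lfloor>y\<rfloor> = 0" using irrD[OF assms] by (simp add: floor_eq_iff)
qed

lemma tower_add_nat: "y \<in> irr \<Longrightarrow> y + real i \<in> tower \<longleftrightarrow> i < height (lead y)"
  by (simp add: tower_def irr_add_nat)

lemma irr_subset_tower: "irr \<subseteq> tower"
  using tower_add_nat[of _ 0] by (auto simp: height_pos)

lemma nonneg_irrational_decomp:
  fixes x :: real
  assumes "0 \<le> x" "x \<notin> \<rat>"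
  obtains y i where "x = y + real i" "y \<in> irr"
proof
  show "x = frac x + real (nat \<lfloor>x\<rfloor>)" using assms by (simp add: frac_def)
  have "frac x \<notin> \<rat>"
  proof
    assume "frac x \<in> \<rat>"
    then have "frac x + of_int \<lfloor>x\<rfloor> \<in> \<rat>" by (intro Rats_add) auto
    then show False using assms by (simp add: frac_def)
  qed
  moreover from this have "frac x \<noteq> 0" by (metis Rats_0)
  ultimately show "frac x \<in> irr" using frac_ge_0[of x] frac_lt_1[of x] by (auto simp: irr_def less_le)
qed

lemma tower_cases:
  assumes "x \<in> tower"
  obtains y i where "x = y + real i" "y \<in> irr" "i < height (lead y)"
proof -
  from assms obtain y i where "x = y + real i" "y \<in> irr"
    using nonneg_irrational_decomp[of x] by (auto simp: tower_def)
  with assms show ?thesis using that tower_add_nat by metis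
qed

lemma climb_add_nat:
  "y \<in> irr \<Longrightarrow> climb (y + real i) = (if Suc i < height (lead y) then y + real (Suc i) else odo y)"
  by (simp add: climb_def irr_add_nat)

lemma climb_inv_irr:
  "y \<in> irr \<Longrightarrow> climb_inv y = odo_inv y + real (height (lead (odo_inv y)) - 1)"
  using irrD[of y] by (simp add: climb_inv_def)

lemma climb_inv_add_Suc:
  "y \<in> irr \<Longrightarrow> climb_inv (y + real (Suc i)) = y + real i"
  using irrD[of y] by (simp add: climb_inv_def)

lemma bottom_add_nat: "y \<in> irr \<Longrightarrow> bottom (y + real i) = (if i < ones (lead y) then 1 else 0)"
  by (simp add: bottom_def irr_add_nat)

lemma climb_in_tower: "x \<in> tower \<Longrightarrow> climb x \<in> tower"
  by (erule tower_cases) (use odo_irr irr_subset_tower in \<open>auto simp: climb_add_nat tower_add_nat simp del: of_nat_Suc\<close>)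

lemma climb_inv_in_tower: "x \<in> tower \<Longrightarrow> climb_inv x \<in> tower"
proof (erule tower_cases)
  fix y i assume *: "x = y + real i" "y \<in> irr" "i < height (lead y)"
  show "climb_inv x \<in> tower"
  proof (cases i)
    case 0 then show ?thesis using * height_pos by (auto simp: climb_inv_irr tower_add_nat odo_inv_irr)
  next
    case (Suc n) then show ?thesis using * by (auto simp: climb_inv_add_Suc tower_add_nat simp del: of_nat_Suc)
  qed
qed

lemma climb_inv_climb: "x \<in> tower \<Longrightarrow> climb_inv (climb x) = x"
proof (erule tower_cases)
  fix y i assume *: "x = y + real i" "y \<in> irr" "i < height (lead y)"
  show "climb_inv (climb x) = x"
  proof (cases "Suc i < height (lead y)")
    case True then show ?thesis using * by (simp add: climb_add_nat climb_inv_add_Suc del: of_nat_Suc)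
  next
    case False then have "i = height (lead y) - 1" using * by simp
    then show ?thesis using * False by (simp add: climb_add_nat climb_inv_irr odo_irr odo_inv_odo del: of_nat_diff)
  qed
qed

lemma climb_climb_inv: "x \<in> tower \<Longrightarrow> climb (climb_inv x) = x"
proof (erule tower_cases)
  fix y i assume *: "x = y + real i" "y \<in> irr" "i < height (lead y)"
  show "climb (climb_inv x) = x"
  proof (cases i)
    case 0
    then have "x = y" using * by simp
    then show ?thesis using * height_pos[of "lead (odo_inv y)"]
      by (simp add: climb_inv_irr climb_add_nat odo_inv_irr odo_odo_inv del: of_nat_diff)
  next
    case (Suc n) then show ?thesis using * by (simp add: climb_inv_add_Suc climb_add_nat del: of_nat_Suc)
  qed
qed

lemma bij_betw_climb: "bij_betw climb tower tower"
  by (rule bij_betw_byWitness[where f' = climb_inv])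
     (auto simp: climb_inv_climb climb_climb_inv climb_in_tower climb_inv_in_tower)

lemma climb_diff_Rats: "x \<in> tower \<Longrightarrow> climb x - x \<in> \<rat>"
proof (erule tower_cases)
  fix y i assume *: "x = y + real i" "y \<in> irr" "i < height (lead y)"
  have "odo y - (y + real i) = (odo y - y) - real i" by simp
  also have "\<dots> \<in> \<rat>" by (intro Rats_diff odo_diff_Rats) auto
  finally show "climb x - x \<in> \<rat>" using * by (auto simp: climb_add_nat)
qed

lemma climb_pow_in_tower: "x \<in> tower \<Longrightarrow> (climb ^^ n) x \<in> tower"
  by (induction n) (auto simp: climb_in_tower)

lemma climb_inv_pow_in_tower: "x \<in> tower \<Longrightarrow> (climb_inv ^^ n) x \<in> tower"
  by (induction n) (auto simp: climb_inv_in_tower)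

section \<open>Passage of orbits through whole columns\<close>

lemma climb_pow_add_nat:
  assumes "y \<in> irr" "i + k < height (lead y)"
  shows "(climb ^^ k) (y + real i) = y + real (i + k)"
  using assms by (induction k) (auto simp: climb_add_nat simp del: of_nat_add of_nat_Suc)

lemma climb_pow_exit:
  assumes "y \<in> irr" "i < height (lead y)"
  shows "(climb ^^ (height (lead y) - i)) (y + real i) = odo y"
proof -
  obtain k where k: "height (lead y) = Suc (i + k)" using less_imp_Suc_add[OF assms(2)] by blast
  then have "(climb ^^ Suc k) (y + real i) = climb (y + real (i + k))"
    using climb_pow_add_nat[of y i k] assms by simp
  also have "\<dots> = odo y" using k assms by (simp add: climb_add_nat del: of_nat_add)
  finally show ?thesis using k by (simp add: Suc_diff_le)
qed

text \<open>Each odometer step is one whole column, and crossing it from level 0 takes exactly its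
  height in steps of \<open>climb\<close>.\<close>

lemma climb_pow_odo_pow:
  assumes "y \<in> irr" "\<And>l. l < k \<Longrightarrow> height (lead ((odo ^^ l) y)) \<le> B"
  shows "\<exists>m\<le>k * B. (climb ^^ m) y = (odo ^^ k) y"
  using assms
proof (induction k)
  case 0 then show ?case by auto
next
  case (Suc k)
  then obtain m where m: "m \<le> k * B" "(climb ^^ m) y = (odo ^^ k) y" by force
  define z where "z = (odo ^^ k) y"
  have z: "z \<in> irr" "height (lead z) \<le> B" using Suc.prems odo_pow_irr by (auto simp: z_def)
  have "(climb ^^ (height (lead z) + m)) y = odo z"
    using climb_pow_exit[of z 0] z height_pos m by (simp add: funpow_add z_def)
  then show ?case using m z by (intro exI[of _ "height (lead z) + m"]) (auto simp: z_def)
qed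

lemma climb_orbit_contains_odo_orbit:
  assumes "y \<in> irr" shows "\<exists>m. (climb ^^ m) y = (odo ^^ k) y"
proof -
  \<comment> \<open>For k = 0 the \<open>Max\<close> of the empty set is unspecified, but it is then
    multiplied by 0.\<close>
  have "\<exists>m\<le>k * Max ((\<lambda>l. height (lead ((odo ^^ l) y))) ` {..<k}). (climb ^^ m) y = (odo ^^ k) y"
    using assms by (rule climb_pow_odo_pow) (auto intro!: Max_ge)
  then show ?thesis by blast
qed

lemma climb_orbit_dyadic:
  assumes "x \<in> irr" "x < 1 / 2^n" "k < 2^n"
  shows "\<exists>m. (climb ^^ m) x = x + real k / 2^n"
  using odo_orbit_dyadic[OF assms] climb_orbit_contains_odo_orbit[OF assms(1)] by metis

section \<open>Averages along the orbits\<close>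

lemma limsup_birkhoff_avg_eq_1I:
  assumes le1: "\<And>x. f x \<le> 1"
    and ge: "\<And>e N. 0 < e \<Longrightarrow> \<exists>n\<ge>N. birkhoff_avg n x f T \<ge> 1 - e"
  shows "limsup (\<lambda>n. ereal (birkhoff_avg n x f T)) = 1"
proof (rule antisym)
  have "birkhoff_avg n x f T \<le> 1" for n
  proof -
    have "(\<Sum>k<n. f ((T ^^ k) x)) \<le> real n" using sum_bounded_above[of "{..<n}" "\<lambda>k. f ((T ^^ k) x)" 1] le1 by simp
    \<comment> \<open>At n = 0 the convention 1 / 0 = 0 makes the average 0.\<close>
    then show ?thesis by (cases "n = 0") (auto simp: birkhoff_avg_def field_simps)
  qed
  then show "limsup (\<lambda>n. ereal (birkhoff_avg n x f T)) \<le> 1"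
    by (intro Limsup_bounded) (auto simp: one_ereal_def)
  show "1 \<le> limsup (\<lambda>n. ereal (birkhoff_avg n x f T))"
  proof (rule ccontr)
    assume "\<not> 1 \<le> limsup (\<lambda>n. ereal (birkhoff_avg n x f T))"
    then obtain r where r: "limsup (\<lambda>n. ereal (birkhoff_avg n x f T)) < ereal r" "ereal r < 1"
      using ereal_dense2[of "limsup (\<lambda>n. ereal (birkhoff_avg n x f T))" 1] by (auto simp: not_le)
    have "eventually (\<lambda>n. ereal (birkhoff_avg n x f T) < ereal r) sequentially"
      using r(1) Limsup_le_iff[of sequentially "\<lambda>n. ereal (birkhoff_avg n x f T)"] by blast
    then obtain N where "\<And>n. n \<ge> N \<Longrightarrow> birkhoff_avg n x f T < r"
      by (auto simp: eventually_sequentially)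
    moreover have "0 < 1 - r" using r(2) by (simp add: one_ereal_def)
    ultimately show False using ge[of "1 - r" N] by fastforce
  qed
qed

text \<open>After the initial column is left, the first column with \<open>lead\<close> above j is
  reached at time M and starts with at least \<open>a\<close> ones. The aim is M \<le> e * a,
  because then the average at time a + M is at least a / (a + M) \<ge> 1 - e.\<close>

lemma birkhoff_avg_climb_large:
  assumes x: "x \<in> tower" and e: "0 < e"
  shows "\<exists>n\<ge>N. birkhoff_avg n x bottom climb \<ge> 1 - e"
proof -
  obtain y i where yi: "x = y + real i" "y \<in> irr" "i < height (lead y)" using x by (rule tower_cases)
  \<comment> \<open>The time needed to leave the initial column, whose crossing may start
    midway.\<close>
  define m0 where "m0 = height (lead y) - i"
  define p where "p = odo y"
  have p: "p \<in> irr" "(climb ^^ m0) x = p" using yi climb_pow_exit[of y i] odo_irr by (auto simp: m0_def p_def)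
  \<comment> \<open>This quotient will bound M / a once the common factor \<open>ones j\<close> is
    cancelled; its denominator is the ratio in \<open>ones_Suc\<close>.\<close>
  have "(\<lambda>j. (real m0 + 2^Suc j * real (Suc j)) / (2 * 4^j)) \<longlonglongrightarrow> 0"
    by real_asymp
  then have "eventually (\<lambda>j. (real m0 + 2^Suc j * real (Suc j)) / (2 * 4^j) < e) sequentially"
    using e by (rule order_tendstoD)
  then have "eventually (\<lambda>j. (real m0 + 2^Suc j * real (Suc j)) / (2 * 4^j) < e \<and> N \<le> j) sequentially"
    by (intro eventually_conj eventually_ge_at_top)
  then obtain j where j: "(real m0 + 2^Suc j * real (Suc j)) / (2 * 4^j) < e" "N \<le> j"
    unfolding eventually_sequentially by blast
  \<comment> \<open>Minimality of k bounds the height of every column crossed on the way by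
    \<open>height j\<close>.\<close>
  define k where "k = (LEAST k. Suc j \<le> lead ((odo ^^ k) p))"
  obtain k' where k': "k' < 2^Suc j" "Suc j \<le> lead ((odo ^^ k') p)" using odo_orbit_hits_lead[OF p(1)] by blast
  have k1: "Suc j \<le> lead ((odo ^^ k) p)" unfolding k_def using k' by (rule_tac LeastI)
  have k2: "k \<le> 2^Suc j" unfolding k_def using k' by (meson Least_le less_imp_le order_trans)
  have "lead ((odo ^^ l) p) \<le> j" if "l < k" for l
    using not_less_Least[of l "\<lambda>k. Suc j \<le> lead ((odo ^^ k) p)"] that unfolding k_def by simp
  then have "\<exists>m\<le>k * height j. (climb ^^ m) p = (odo ^^ k) p"
    using p(1) by (intro climb_pow_odo_pow height_mono) auto
  then obtain m where m: "m \<le> k * height j" "(climb ^^ m) p = (odo ^^ k) p" by blast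
  define q where "q = (odo ^^ k) p"
  define M where "M = m + m0"
  define a where "a = ones (Suc j)"
  have q: "q \<in> irr" "Suc j \<le> lead q" using k1 p by (auto simp: q_def odo_pow_irr)
  have Mq: "(climb ^^ M) x = q" using m p by (simp add: M_def funpow_add q_def)
  have bq: "bottom ((climb ^^ (l + M)) x) = 1" if "l < a" for l
  proof -
    have "l < ones (lead q)" using that ones_mono[OF q(2)] by (simp add: a_def)
    moreover from this have "l < height (lead q)" using ones_le_height[of "lead q"] by simp
    ultimately show ?thesis using climb_pow_add_nat[of q 0 l] q by (simp add: funpow_add Mq bottom_add_nat)
  qed
  have "real a = (\<Sum>l<a. bottom ((climb ^^ (l + M)) x))" using bq by simp
  also have "\<dots> = (\<Sum>l\<in>{M..<a+M}. bottom ((climb ^^ l) x))"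
    using sum.shift_bounds_nat_ivl[of "\<lambda>l. bottom ((climb ^^ l) x)" 0 M a] by (simp add: lessThan_atLeast0)
  also have "\<dots> \<le> (\<Sum>l<a+M. bottom ((climb ^^ l) x))"
    by (intro sum_mono2) (auto simp: bottom_def)
  finally have S: "real a \<le> (\<Sum>l<a+M. bottom ((climb ^^ l) x))" .
  have a1: "real a = 2 * 4^j * real (ones j)" by (simp add: a_def ones_Suc)
  have apos: "real a > 0" using ones_pos by (simp add: a_def)
  have "m \<le> 2^Suc j * (Suc j * ones j)" using m(1) mult_le_mono1[OF k2, of "height j"] unfolding height_def by (rule order_trans)
  then have "real m \<le> real (2^Suc j * (Suc j * ones j))" by (simp only: of_nat_le_iff)
  then have "real m \<le> 2^Suc j * (real (Suc j) * real (ones j))" by (simp only: of_nat_mult of_nat_power of_nat_numeral)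
  \<comment> \<open>The constant m0 is inflated by \<open>ones j\<close> so that it fits under the
    common factor.\<close>
  moreover have "real m0 \<le> real m0 * real (ones j)" using ones_pos[of j] mult_left_mono[of 1 "real (ones j)" "real m0"] by simp
  ultimately have "real M \<le> (real m0 + 2^Suc j * real (Suc j)) * real (ones j)"
    by (simp add: M_def algebra_simps)
  also have "\<dots> = (real m0 + 2^Suc j * real (Suc j)) / (2 * 4^j) * real a"
    by (simp add: a1)
  also have "\<dots> \<le> e * real a" using j(1) apos by (intro mult_right_mono) auto
  finally have Me: "real M \<le> e * real a" .
  have "(1 - e) * (real a + real M) \<le> real a"
  proof -
    have "e * real M \<ge> 0" using e by simp
    then show ?thesis using Me by (simp add: algebra_simps)
  qed
  then have "birkhoff_avg (a + M) x bottom climb \<ge> 1 - e"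
    using S apos by (simp add: birkhoff_avg_def field_simps)
  \<comment> \<open>Together with N \<le> j this makes the averaging time a + M at least N.\<close>
  moreover have "j \<le> a"
  proof -
    have "j < 2^j" by simp
    also have "(2::nat)^j \<le> 2^((Suc j)^2)" by (intro power_increasing) (auto simp: power2_eq_square)
    finally show ?thesis by (simp add: a_def ones_def)
  qed
  ultimately show ?thesis using j(2) by (intro exI[of _ "a+M"]) auto
qed

section \<open>Averages going down, by a potential estimate\<close>

lemma telescoping_bound:
  fixes \<phi> f :: "'a \<Rightarrow> real"
  assumes "\<And>x. x \<in> A \<Longrightarrow> T x \<in> A"
    and "\<And>x. x \<in> A \<Longrightarrow> \<phi> (T x) \<le> \<phi> x + e - f x" "\<And>x. x \<in> A \<Longrightarrow> 0 \<le> \<phi> x" and x: "x \<in> A"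
  shows "(\<Sum>k<n. f ((T ^^ k) x)) \<le> e * real n + \<phi> x"
proof -
  have *: "(T ^^ k) x \<in> A" for k by (induction k) (auto simp: assms)
  \<comment> \<open>The final potential is kept so that the induction telescopes; nonnegativity
    removes it afterwards.\<close>
  have "(\<Sum>k<n. f ((T ^^ k) x)) \<le> e * real n + \<phi> x - \<phi> ((T ^^ n) x)"
  proof (induction n)
    case (Suc n)
    then show ?case using assms(2)[OF *[of n]] by (simp add: algebra_simps)
  qed simp
  then show ?thesis using assms(3)[OF *[of n]] by linarith
qed

text \<open>Time is counted in columns, not in levels. The value is 0 when \<open>lead y\<close> is
  already at least j.\<close>

definition wait :: "nat \<Rightarrow> real \<Rightarrow> nat" where
  "wait j y = (LEAST k. j \<le> lead ((odo_inv ^^ k) y))"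

lemma wait_ex: "y \<in> irr \<Longrightarrow> \<exists>k. j \<le> lead ((odo_inv ^^ k) y)"
  using odo_inv_orbit_hits_lead by blast

lemma wait_le: "y \<in> irr \<Longrightarrow> wait j y \<le> 2^j"
  unfolding wait_def using odo_inv_orbit_hits_lead[of y j] by (meson Least_le less_imp_le order_trans)

lemma wait_eq_Suc:
  assumes "y \<in> irr" "lead y < j" shows "wait j y = Suc (wait j (odo_inv y))"
proof -
  obtain k where "j \<le> lead ((odo_inv ^^ k) y)" using wait_ex[OF assms(1)] by blast
  then show ?thesis unfolding wait_def using assms(2)
    by (subst Least_Suc) (auto simp: funpow_swap1)
qed

text \<open>For a point about to be visited going down, the potential bounds the amount by which the number
  of ones met from now on can exceed the fraction \<open>2/(j+1)\<close> of the elapsed time, before the next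
  column with \<open>lead > j\<close> is completed. Columns with \<open>lead \<le> j\<close> cost at most \<open>ones j\<close> each.\<close>

definition potential :: "nat \<Rightarrow> real \<Rightarrow> nat \<Rightarrow> real" where
  "potential j y i = (if Suc j \<le> lead y
     then max 0 (2^Suc j * real (ones j) + real (min (Suc i) (ones (lead y))) - 2 / Suc j * Suc i)
     else real (ones j) * (real (wait (Suc j) y) - 1) + real (min (Suc i) (ones (lead y))))"

text \<open>If l = \<open>lead y\<close> exceeds j, then 2 / (j+1) times the height is at least 2 *
  \<open>ones l\<close>. One half pays for the ones of the column, the other for the reserve 2^(j+1)
  * \<open>ones j\<close>, so the truncated potential is 0. Otherwise the column has at most
  \<open>ones j\<close> ones, the price of one column of waiting.\<close>

lemma potential_top:
  assumes y: "y \<in> irr"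
  shows "potential j y (height (lead y) - 1) \<le> ones j * wait (Suc j) y"
proof (cases "Suc j \<le> lead y")
  case True
  let ?l = "lead y"
  obtain i where l: "?l = Suc i" "j \<le> i" using True by (cases "lead y") auto
  have h: "Suc (height ?l - 1) = height ?l" using height_pos[of ?l] by simp
  have "2^Suc j * ones j \<le> 2^Suc i * ones i"
    using l by (intro mult_mono power_increasing ones_mono) auto
  also have "\<dots> \<le> 2 * 4^i * ones i" by (intro mult_right_mono) (auto intro: power_mono)
  also have "\<dots> = ones ?l" by (simp add: ones_Suc l)
  finally have 1: "2^Suc j * real (ones j) \<le> real (ones ?l)"
    by (metis of_nat_le_iff of_nat_mult of_nat_numeral of_nat_power)
  have "2 * real (ones ?l) \<le> 2 / Suc j * (real (Suc ?l) * real (ones ?l))"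
  proof -
    have "real (Suc j) * real (ones ?l) \<le> real (Suc ?l) * real (ones ?l)" using True by (intro mult_right_mono) auto
    then show ?thesis by (simp add: field_simps)
  qed
  also have "\<dots> = 2 / Suc j * height ?l" by (simp only: height_def of_nat_mult)
  finally have "2^Suc j * real (ones j) + real (min (Suc (height ?l - 1)) (ones ?l)) - 2 / Suc j * Suc (height ?l - 1) \<le> 0"
    using 1 ones_le_height[of ?l] unfolding h by simp
  then have "potential j y (height ?l - 1) = 0" using True by (simp add: potential_def)
  then show ?thesis by simp
next
  case False
  then have "wait (Suc j) y = Suc (wait (Suc j) (odo_inv y))" using y by (intro wait_eq_Suc) auto
  moreover have "ones (lead y) \<le> ones j" using False by (intro ones_mono) auto
  moreover have "Suc (height (lead y) - 1) = height (lead y)" using height_pos[of "lead y"] by simp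
  ultimately show ?thesis using False ones_le_height[of "lead y"]
    by (simp add: potential_def algebra_simps)
qed

lemma potential_nonneg:
  assumes "y \<in> irr" shows "0 \<le> potential j y i"
proof (cases "Suc j \<le> lead y")
  case False
  \<comment> \<open>Hence the wait is at least 1, and subtracting 1 from it in the potential leaves
    a nonnegative number.\<close>
  then have "wait (Suc j) y = Suc (wait (Suc j) (odo_inv y))" using assms by (intro wait_eq_Suc) auto
  then show ?thesis using False by (simp add: potential_def)
qed (simp add: potential_def)

lemma potential_step_Suc:
  assumes "y \<in> irr"
  shows "potential j y i \<le> potential j y (Suc i) + 2 / Suc j - (if Suc i < ones (lead y) then 1 else 0)"
proof (cases "Suc j \<le> lead y")
  case True
  define \<epsilon> where "\<epsilon> = 2 / real (Suc j)"
  define c where "c = 2^Suc j * real (ones j)"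
  have pos: "0 \<le> c" "0 \<le> \<epsilon>" by (auto simp: c_def \<epsilon>_def)
  have p: "potential j y k = max 0 (c + real (min (Suc k) (ones (lead y))) - \<epsilon> * real (Suc k))" for k
    using True by (simp add: potential_def c_def \<epsilon>_def)
  show ?thesis
  proof (cases "Suc i < ones (lead y)")
    case less: True
    \<comment> \<open>This covers the case where truncation makes the potential at level i equal to
      0. For \<epsilon> \<le> 1 the untruncated value suffices; otherwise 1 - \<epsilon> is
      negative.\<close>
    have "1 - \<epsilon> \<le> max 0 (c + real (Suc (Suc i)) - \<epsilon> * real (Suc (Suc i)))"
    proof (cases "\<epsilon> \<le> 1")
      case True
      then have "0 \<le> (1 - \<epsilon>) * real (Suc i)" by (intro mult_nonneg_nonneg) auto
      then show ?thesis using pos by (simp add: algebra_simps)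
    qed simp
    moreover have "min (Suc i) (ones (lead y)) = Suc i" "min (Suc (Suc i)) (ones (lead y)) = Suc (Suc i)"
      using less by auto
    ultimately show ?thesis unfolding p \<epsilon>_def[symmetric] using less by (simp add: algebra_simps)
  next
    case False
    then have "min (Suc i) (ones (lead y)) = ones (lead y)" "min (Suc (Suc i)) (ones (lead y)) = ones (lead y)" by auto
    then show ?thesis unfolding p \<epsilon>_def[symmetric] using False pos by (simp add: algebra_simps)
  qed
next
  case False
  define \<epsilon> where "\<epsilon> = 2 / real (Suc j)"
  have "0 \<le> \<epsilon>" by (simp add: \<epsilon>_def)
  then show ?thesis using False unfolding potential_def min_def \<epsilon>_def[symmetric] by auto
qed

text \<open>On leaving a column with \<open>lead\<close> above j, the reserve 2^(j+1) *
  \<open>ones j\<close> pays for the coming wait, which \<open>wait_le\<close> bounds by 2^(j+1). On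
  leaving a lower column, the wait shortens by one.\<close>

lemma potential_step_0:
  assumes "y \<in> irr"
  shows "ones j * wait (Suc j) (odo_inv y) \<le> potential j y 0 + 2 / Suc j - 1"
proof (cases "Suc j \<le> lead y")
  case True
  have "real (wait (Suc j) (odo_inv y)) \<le> 2^Suc j" using wait_le[OF odo_inv_irr[OF assms]]
    by (metis of_nat_le_iff of_nat_numeral of_nat_power)
  then have "real (ones j) * real (wait (Suc j) (odo_inv y)) \<le> real (ones j) * 2^Suc j" by (intro mult_left_mono) auto
  then show ?thesis using True ones_pos[of "lead y"] by (simp add: potential_def min_def mult.commute split: if_splits)
next
  case False
  then have "wait (Suc j) y = Suc (wait (Suc j) (odo_inv y))" using assms by (intro wait_eq_Suc) auto
  then show ?thesis using False ones_pos[of "lead y"] by (simp add: potential_def)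
qed

lemma sum_bottom_climb_inv_le:
  assumes x: "x \<in> tower"
  shows "(\<Sum>k<n. bottom ((climb_inv ^^ k) x)) \<le> 2 / Suc j * real n + potential j (frac x) (nat \<lfloor>x\<rfloor>)"
proof (rule telescoping_bound[where A = tower and T = climb_inv and f = bottom])
  fix x assume "x \<in> tower"
  then obtain y i where yi: "x = y + real i" "y \<in> irr" "i < height (lead y)" by (rule tower_cases)
  show "climb_inv x \<in> tower" by (rule climb_inv_in_tower) fact
  show "0 \<le> potential j (frac x) (nat \<lfloor>x\<rfloor>)" using yi by (simp add: irr_add_nat potential_nonneg)
  show "potential j (frac (climb_inv x)) (nat \<lfloor>climb_inv x\<rfloor>) \<le> potential j (frac x) (nat \<lfloor>x\<rfloor>) + 2 / Suc j - bottom x"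
  proof (cases i)
    case 0
    have "potential j (frac (climb_inv x)) (nat \<lfloor>climb_inv x\<rfloor>) \<le> ones j * wait (Suc j) (odo_inv y)"
      using yi 0 potential_top[OF odo_inv_irr[OF yi(2)]] by (simp add: climb_inv_irr irr_add_nat odo_inv_irr)
    also have "\<dots> \<le> potential j y 0 + 2 / Suc j - 1" by (rule potential_step_0[OF yi(2)])
    also have "\<dots> = potential j (frac x) (nat \<lfloor>x\<rfloor>) + 2 / Suc j - bottom x"
      using bottom_add_nat[of y 0] irr_add_nat(1,2)[of y 0] yi 0 ones_pos by simp
    finally show ?thesis .
  next
    case (Suc k)
    then show ?thesis using yi potential_step_Suc[of y j k]
      by (simp add: climb_inv_add_Suc bottom_add_nat irr_add_nat del: of_nat_Suc)
  qed
qed (use x in auto)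

lemma birkhoff_avg_climb_inv_tendsto:
  assumes x: "x \<in> tower"
  shows "(\<lambda>n. birkhoff_avg n x bottom climb_inv) \<longlonglongrightarrow> 0"
proof (rule LIMSEQ_I)
  fix e :: real assume e: "0 < e"
  obtain j where j: "2 / real (Suc j) < e / 2"
    using reals_Archimedean[of "e/4"] e by (auto simp: field_simps)
  \<comment> \<open>With j fixed, the potential of the starting point is a constant, so its share of
    the average vanishes.\<close>
  define C where "C = potential j (frac x) (nat \<lfloor>x\<rfloor>)"
  have "(\<lambda>n. C / real n) \<longlonglongrightarrow> 0" by real_asymp
  then have "eventually (\<lambda>n. C / real n < e / 2) sequentially" using e by (intro order_tendstoD) auto
  then have "eventually (\<lambda>n. norm (birkhoff_avg n x bottom climb_inv - 0) < e) sequentially"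
    using eventually_gt_at_top[of 0]
  proof eventually_elim
    case (elim n)
    let ?S = "\<Sum>k<n. bottom ((climb_inv ^^ k) x)"
    have "?S \<ge> 0" by (intro sum_nonneg) (auto simp: bottom_def)
    then have "norm (birkhoff_avg n x bottom climb_inv - 0) = ?S / real n" by (simp add: birkhoff_avg_def)
    also have "\<dots> \<le> (2 / Suc j * real n + C) / real n"
      using sum_bottom_climb_inv_le[OF x] unfolding C_def by (intro divide_right_mono) auto
    also have "\<dots> = 2 / Suc j + C / real n" using elim by (simp add: field_simps)
    finally show ?case using elim j by linarith
  qed
  then show "\<exists>n0. \<forall>n\<ge>n0. norm (birkhoff_avg n x bottom climb_inv - 0) < e"
    by (simp add: eventually_sequentially)
qed

section \<open>Lebesgue measure and dyadic translations\<close>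

lemma emeasure_lborel_translate:
  fixes A :: "real set"
  assumes "A \<in> sets borel"
  shows "emeasure lborel {x. x - c \<in> A} = emeasure lborel A"
proof -
  have "emeasure lborel A = emeasure (distr lborel borel ((+) (- c))) A" by (simp add: lborel_distr_plus)
  also have "\<dots> = emeasure lborel ((+) (- c) -` A \<inter> space lborel)" using assms by (intro emeasure_distr) auto
  also have "(+) (- c) -` A \<inter> space lborel = {x. x - c \<in> A}" by auto
  finally show ?thesis ..
qed

text \<open>T is translation by c on each of the countably many Borel pieces \<open>A c\<close>.
  Surjectivity makes the translated pieces cover E, and injectivity makes them disjoint.\<close>

lemma emeasure_preserved_rational_translations:
  fixes T :: "real \<Rightarrow> real"
  assumes [measurable]: "T \<in> borel_measurable borel" "\<Omega> \<in> sets borel" "E \<in> sets borel"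
    and bij: "bij_betw T \<Omega> \<Omega>" and rat: "\<And>x. x \<in> \<Omega> \<Longrightarrow> T x - x \<in> \<rat>" and E: "E \<subseteq> \<Omega>"
  shows "emeasure lborel (T -` E \<inter> \<Omega>) = emeasure lborel E"
proof -
  define A where "A c = {x. x \<in> \<Omega> \<and> T x = x + c \<and> T x \<in> E}" for c
  have [measurable]: "A c \<in> sets borel" for c unfolding A_def by measurable
  have [measurable]: "{x. x - c \<in> A c} \<in> sets borel" for c by measurable
  have 1: "T -` E \<inter> \<Omega> = (\<Union>c\<in>\<rat>. A c)"
  proof safe
    fix x assume "x \<in> \<Omega>" "T x \<in> E"
    then show "x \<in> (\<Union>c\<in>\<rat>. A c)" using rat[of x] by (auto simp: A_def intro!: bexI[of _ "T x - x"])
  qed (auto simp: A_def)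
  have 2: "E = (\<Union>c\<in>\<rat>. {x. x - c \<in> A c})"
  proof safe
    fix y assume y: "y \<in> E"
    then have "y \<in> T ` \<Omega>" using E bij_betw_imp_surj_on[OF bij] by auto
    then obtain x where "x \<in> \<Omega>" "T x = y" by blast
    then show "y \<in> (\<Union>c\<in>\<rat>. {x. x - c \<in> A c})"
      using rat[of x] y by (auto simp: A_def intro!: bexI[of _ "T x - x"])
  qed (auto simp: A_def)
  have inj: "inj_on T \<Omega>" using bij by (simp add: bij_betw_def)
  have "emeasure lborel (T -` E \<inter> \<Omega>) = (\<integral>\<^sup>+c. emeasure lborel (A c) \<partial>count_space \<rat>)"
    unfolding 1 by (rule emeasure_UN_countable) (auto simp: countable_rat disjoint_family_on_def A_def)
  also have "\<dots> = (\<integral>\<^sup>+c. emeasure lborel {x. x - c \<in> A c} \<partial>count_space \<rat>)"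
    by (intro nn_integral_cong) (simp add: emeasure_lborel_translate)
  also have "\<dots> = emeasure lborel (\<Union>c\<in>\<rat>. {x. x - c \<in> A c})"
  proof (rule emeasure_UN_countable[symmetric])
    show "disjoint_family_on (\<lambda>c. {x. x - c \<in> A c}) \<rat>"
      unfolding disjoint_family_on_def
    proof (intro ballI impI equals0I)
      fix c d y assume cd: "c \<noteq> d" and y: "y \<in> {x. x - c \<in> A c} \<inter> {x. x - d \<in> A d}"
      then have "T (y - c) = T (y - d)" "y - c \<in> \<Omega>" "y - d \<in> \<Omega>" by (auto simp: A_def)
      then have "y - c = y - d" using inj by (auto dest: inj_onD)
      then show False using cd by simp
    qed
  qed (auto simp: countable_rat)
  finally show ?thesis using 2 by simp
qed

section \<open>Borel measurability of the maps and sets\<close>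

lemma measurable_lead [measurable]: "lead \<in> borel \<rightarrow>\<^sub>M count_space UNIV"
  unfolding lead_def by measurable

lemma measurable_odo [measurable]: "odo \<in> borel_measurable borel"
  unfolding odo_def by measurable

lemma measurable_odo_inv [measurable]: "odo_inv \<in> borel_measurable borel"
  unfolding odo_inv_def by measurable

lemma measurable_frac_real [measurable]: "(frac :: real \<Rightarrow> real) \<in> borel_measurable borel"
  unfolding frac_def[abs_def] by measurable

lemma measurable_climb [measurable]: "climb \<in> borel_measurable borel"
  unfolding climb_def by measurable

lemma measurable_climb_inv [measurable]: "climb_inv \<in> borel_measurable borel"
  unfolding climb_inv_def by measurable

lemma measurable_bottom [measurable]: "bottom \<in> borel_measurable borel"
  unfolding bottom_def by measurable

lemma sets_Rats [measurable]: "(\<rat> :: real set) \<in> sets borel"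
  by (rule sets.countable) (auto simp: countable_rat)

lemma sets_irr [measurable]: "irr \<in> sets borel"
  unfolding irr_def by measurable

lemma sets_tower [measurable]: "tower \<in> sets borel"
  unfolding tower_def by measurable

section \<open>Infinite total mass\<close>

lemma emeasure_diff_Rats:
  fixes A :: "real set"
  assumes "A \<in> sets borel" shows "emeasure lborel (A - \<rat>) = emeasure lborel A"
  by (rule emeasure_Diff_null_set)
     (use assms countable_imp_null_set_lborel[OF countable_rat] in auto)

text \<open>The base \<open>{lead = j}\<close> has length 2^-(j+1) and carries columns of height
  (j+1) * 2^(j^2), so the mass over it is unbounded in j.\<close>

lemma emeasure_lborel_tower: "emeasure lborel tower = \<infinity>"
proof -
  have "of_nat n \<le> emeasure lborel tower" for n
  proof -
    \<comment> \<open>With this j the lower bound (j+1) * 2^j * 2^-(j+1) for the mass equals n +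
      1.\<close>
    define j where "j = 2 * n + 1"
    define I where "I i = {real i + (1 - (1/2)^j)<..<real i + (1 - (1/2)^Suc j)} - \<rat>" for i
    have hp: "0 < (1/2::real)^j" "(1/2::real)^j \<le> 1" by (auto simp: power_le_one)
    have sub: "I i \<subseteq> tower \<inter> {real i<..<real (Suc i)}" if "i < height j" for i
    proof
      fix x assume x: "x \<in> I i"
      have "(x - real i) + real i \<notin> \<rat>" using x by (simp add: I_def)
      then have "x - real i \<notin> \<rat>" by (subst (asm) add_Rats_iff) auto
      moreover have "0 < x - real i" "x - real i < 1" using x hp by (auto simp: I_def)
      ultimately have y: "x - real i \<in> irr" by (auto simp: irr_def)
      have "lead (x - real i) = j" using x by (intro lead_eqI) (auto simp: I_def)
      then show "x \<in> tower \<inter> {real i<..<real (Suc i)}" using tower_add_nat[OF y, of i] that y by (auto simp: irr_def)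
    qed
    have n_le: "of_nat n \<le> ennreal (real (height j) * (1/2)^Suc j)"
    proof -
      have "j \<le> j^2" by (simp add: power2_eq_square j_def)
      then have "real (Suc j) * 2^j \<le> real (Suc j) * 2^(j^2)"
        by (intro mult_left_mono power_increasing) auto
      then have "real (Suc j) * 2^j \<le> real (height j)"
        by (simp only: height_def ones_def of_nat_mult of_nat_power of_nat_numeral)
      then have "real (Suc j) * 2^j * (1/2)^Suc j \<le> real (height j) * (1/2)^Suc j"
        by (intro mult_right_mono) auto
      moreover have "real (Suc j) * 2^j * (1/2)^Suc j = real n + 1"
        by (simp add: j_def power_one_over field_simps)
      ultimately have "real n \<le> real (height j) * (1/2)^Suc j" by linarith
      then show ?thesis unfolding ennreal_of_nat_eq_real_of_nat by (rule ennreal_leI)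
    qed
    have "emeasure lborel (I i) = ennreal ((1/2)^Suc j)" for i
      unfolding I_def by (subst emeasure_diff_Rats) auto
    then have "ennreal (real (height j) * (1/2)^Suc j) = (\<Sum>i<height j. emeasure lborel (I i))"
      by (simp add: ennreal_mult[symmetric] ennreal_of_nat_eq_real_of_nat)
    also have "\<dots> = emeasure lborel (\<Union>i<height j. I i)"
    proof (rule sum_emeasure)
      show "disjoint_family_on I {..<height j}"
        unfolding disjoint_family_on_def
      proof (intro ballI impI equals0I)
        fix i k x assume "i \<in> {..<height j}" "k \<in> {..<height j}" "i \<noteq> k" "x \<in> I i \<inter> I k"
        then show False using sub[of i] sub[of k] by (cases "i < k") fastforce+
      qed
    qed (auto simp: I_def)
    also have "\<dots> \<le> emeasure lborel tower" using sub by (intro emeasure_mono) auto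
    finally show ?thesis using n_le by (rule order_trans[rotated])
  qed
  then show ?thesis by (metis ennreal_Ex_less_of_nat infinity_ennreal_def leD top.not_eq_extremum)
qed

section \<open>Sets invariant under dyadic translations\<close>

lemma dyadic_piece_eq:
  assumes E: "E \<in> sets borel" "E \<subseteq> irr" and inv: "\<And>x k. x \<in> irr \<Longrightarrow> x < 1 / 2^n \<Longrightarrow> k < 2^n \<Longrightarrow> x + real k / 2^n \<in> E \<longleftrightarrow> x \<in> E"
    and k: "k < (2::nat)^n"
  shows "emeasure lborel (E \<inter> {real k / 2^n<..<real (Suc k) / 2^n}) = emeasure lborel (E \<inter> {0<..<1 / 2^n})"
proof -
  \<comment> \<open>The hypothesis \<open>inv\<close> only speaks of shifts out of the first dyadic
    interval, so each inclusion argues from the point shifted back there.\<close>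
  have "E \<inter> {real k / 2^n<..<real (Suc k) / 2^n} = {x. x - real k / 2^n \<in> E \<inter> {0<..<1 / 2^n}}" (is "?L = ?R")
  proof (intro set_eqI iffI)
    fix x assume x: "x \<in> ?L"
    define z where "z = x - real k / 2^n"
    have xz: "x = z + real k / 2^n" by (simp add: z_def)
    have "z \<notin> \<rat>" using x E(2) irrD(3)[of x] add_Rats_iff[of "real k / 2^n" z] xz by auto
    moreover have z: "0 < z" "z < 1 / 2^n" using x by (auto simp: z_def add_divide_distrib)
    moreover have "z < 1" using z(2) by (rule less_le_trans) simp
    ultimately have "z \<in> irr" by (auto simp: irr_def)
    then have "z \<in> E" using inv[of z k] z k x xz by auto
    then show "x \<in> ?R" using z by (simp add: z_def)
  next
    fix x assume "x \<in> ?R"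
    then show "x \<in> ?L" using inv[of "x - real k / 2^n" k] k E(2) by (auto simp: add_divide_distrib)
  qed
  then show ?thesis using emeasure_lborel_translate[of "E \<inter> {0<..<1 / 2^n}" "real k / 2^n"] E(1) by simp
qed

lemma measure_initial_dyadic:
  assumes E: "E \<in> sets borel" "E \<subseteq> irr"
    and inv: "\<And>x k. x \<in> irr \<Longrightarrow> x < 1 / 2^n \<Longrightarrow> k < 2^n \<Longrightarrow> x + real k / 2^n \<in> E \<longleftrightarrow> x \<in> E"
    and k: "k \<le> (2::nat)^n"
  shows "measure lborel (E \<inter> {0<..<real k / 2^n}) = real k / 2^n * measure lborel E"
proof -
  have fin: "emeasure lborel (E \<inter> A) < \<infinity>" for A
  proof -
    have "emeasure lborel (E \<inter> A) \<le> emeasure lborel {0<..<1::real}"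
      using E(2) by (intro emeasure_mono) (auto simp: irr_def)
    then show ?thesis by (simp add: le_less_trans)
  qed
  have split: "E \<inter> {0<..<b} = (E \<inter> {0<..<a}) \<union> (E \<inter> {a<..<b})" if "a \<le> b" "0 \<le> a" "a \<notin> E" for a b
  proof (intro set_eqI iffI)
    fix x assume "x \<in> E \<inter> {0<..<b}"
    then show "x \<in> (E \<inter> {0<..<a}) \<union> (E \<inter> {a<..<b})" using that by (cases x a rule: linorder_cases) auto
  qed (use that in auto)
  define e where "e = measure lborel (E \<inter> {0<..<1 / 2^n})"
  have *: "measure lborel (E \<inter> {0<..<real k / 2^n}) = real k * e" if "k \<le> 2^n" for k
    using that
  proof (induction k)
    case (Suc k)
    \<comment> \<open>Breakpoints are rational and so outside E, which lets open intervals be glued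
      together.\<close>
    have "real k / 2^n \<notin> E" using E(2) irrD(3)[of "real k / 2^n"] by auto
    have "E \<inter> {0<..<real (Suc k) / 2^n} =
        (E \<inter> {0<..<real k / 2^n}) \<union> (E \<inter> {real k / 2^n<..<real (Suc k) / 2^n})"
    proof -
      have "real k / 2^n \<le> real (Suc k) / 2^n" "0 \<le> real k / 2^n" by (auto intro: divide_right_mono)
      then show ?thesis using \<open>real k / 2^n \<notin> E\<close> by (rule split)
    qed
    then have "measure lborel (E \<inter> {0<..<real (Suc k) / 2^n}) =
       measure lborel (E \<inter> {0<..<real k / 2^n}) + measure lborel (E \<inter> {real k / 2^n<..<real (Suc k) / 2^n})"
      using fin[of "{0<..<real k / 2^n}"] fin[of "{real k / 2^n<..<real (Suc k) / 2^n}"] E(1)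
      by (simp only:) (intro measure_Union, auto)
    also have "measure lborel (E \<inter> {real k / 2^n<..<real (Suc k) / 2^n}) = e"
      using dyadic_piece_eq[OF E inv, of k] Suc.prems unfolding e_def measure_def by simp
    finally show ?case using Suc by (simp add: algebra_simps)
  qed simp
  have "E \<inter> {0<..<real (2^n) / 2^n} = E" using E(2) by (auto simp: irr_def)
  then have "measure lborel E = 2^n * e" using *[of "2^n"] by simp
  then show ?thesis using *[OF k] by simp
qed

text \<open>E has the same proportion p of every initial interval, so Lebesgue measure restricted to
  E is p times Lebesgue measure on (0,1). Evaluating both on E itself gives p = p * p.\<close>

lemma dyadic_invariant_trivial:
  assumes E: "E \<in> sets borel" "E \<subseteq> irr"
    and inv: "\<And>n x k. x \<in> irr \<Longrightarrow> x < 1 / 2^n \<Longrightarrow> k < 2^n \<Longrightarrow> x + real k / 2^n \<in> E \<longleftrightarrow> x \<in> E"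
  shows "emeasure lborel E = 0 \<or> emeasure lborel (irr - E) = 0"
proof -
  define p where "p = measure lborel E"
  have fin: "emeasure lborel (E \<inter> A) < \<infinity>" for A
  proof -
    have "emeasure lborel (E \<inter> A) \<le> emeasure lborel {0<..<1::real}"
      using E(2) by (intro emeasure_mono) (auto simp: irr_def)
    then show ?thesis by (simp add: le_less_trans)
  qed
  have fm: "E \<inter> A \<in> fmeasurable lborel" if "A \<in> sets borel" for A
    using fin[of A] that E(1) by (auto simp: fmeasurable_def)
  have p0: "0 \<le> p" by (simp add: p_def)
  have Ep: "emeasure lborel E = ennreal p"
    using fm[of UNIV] by (simp add: p_def emeasure_eq_measure2)
  have init: "measure lborel (E \<inter> {0<..<t}) = t * p" if t: "0 \<le> t" "t < 1" for t
  proof -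
    define m where "m = measure lborel (E \<inter> {0<..<t})"
    \<comment> \<open>Both m and t * p lie between the exact values at the dyadic neighbours of t,
      and these differ by p / 2^n.\<close>
    have bound: "\<bar>m - t * p\<bar> \<le> p / 2^n" for n
    proof -
      define k where "k = nat \<lfloor>t * 2^n\<rfloor>"
      have "real k = real_of_int \<lfloor>t * 2^n\<rfloor>" using t unfolding k_def by simp
      then have k: "real k \<le> t * 2^n" "t * 2^n < real (Suc k)" by linarith+
      moreover have "t * 2^n < 1 * 2^n" using t by (intro mult_strict_right_mono) auto
      ultimately have "real k < 2^n" by linarith
      then have k2: "Suc k \<le> 2^n" by (simp add: Suc_le_eq)
      have kt: "real k / 2^n \<le> t" "t \<le> real (Suc k) / 2^n" using k by (auto simp: field_simps)
      have "measure lborel (E \<inter> {0<..<real k / 2^n}) \<le> m"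
        unfolding m_def using kt E(1) by (intro measure_mono_fmeasurable fm) auto
      then have 1: "real k / 2^n * p \<le> m"
        using measure_initial_dyadic[OF E inv, of n k] k2 by (simp add: p_def)
      have "m \<le> measure lborel (E \<inter> {0<..<real (Suc k) / 2^n})"
        unfolding m_def using kt E(1) by (intro measure_mono_fmeasurable fm) auto
      then have 2: "m \<le> real (Suc k) / 2^n * p"
        using measure_initial_dyadic[OF E inv, of n "Suc k"] k2 by (simp add: p_def)
      have "real k / 2^n * p \<le> t * p" "t * p \<le> real (Suc k) / 2^n * p"
        by (rule mult_right_mono[OF kt(1) p0]) (rule mult_right_mono[OF kt(2) p0])
      moreover have "real (Suc k) / 2^n * p = real k / 2^n * p + p / 2^n" by (simp add: field_simps)
      ultimately show ?thesis using 1 2 by linarith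
    qed
    have "(\<lambda>n. p / 2^n) \<longlonglongrightarrow> 0" by real_asymp
    then have "\<bar>m - t * p\<bar> \<le> 0" using bound by (intro LIMSEQ_le_const[of "\<lambda>n. p / 2^n"]) auto
    then show ?thesis by (simp add: m_def)
  qed
  \<comment> \<open>Right half lines are the sets on which \<open>measure_eqI_lessThan\<close>
    compares two measures.\<close>
  have tail: "emeasure lborel (E \<inter> {x<..}) = p * emeasure lborel ({0<..<1} \<inter> {x<..})" for x
  proof -
    consider "x < 0" | "0 \<le> x" "x < 1" | "1 \<le> x" by linarith
    then show ?thesis
    proof cases
      case 1
      then have "E \<inter> {x<..} = E" "{0<..<1::real} \<inter> {x<..} = {0<..<1}" using E(2) by (auto simp: irr_def)
      then show ?thesis using Ep by simp
    next
      case 2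
      have "E \<inter> {x<..} = E - E \<inter> {0<..<x} - {x}" using E(2) by (auto simp: irr_def)
      then have "emeasure lborel (E \<inter> {x<..}) = emeasure lborel (E - E \<inter> {0<..<x})"
        using E(1) countable_imp_null_set_lborel[of "{x}"]
        by (simp only:) (intro emeasure_Diff_null_set, auto)
      also have "\<dots> = emeasure lborel E - emeasure lborel (E \<inter> {0<..<x})"
        using E(1) fin[of "{0<..<x}"] by (intro emeasure_Diff) auto
      also have "\<dots> = ennreal (p - x * p)"
        using Ep init[OF 2] fm[of "{0<..<x}"] 2 p0 by (simp add: emeasure_eq_measure2 ennreal_minus)
      also have "\<dots> = p * ennreal (1 - x)" using p0 2 by (simp add: ennreal_mult'[symmetric] algebra_simps)
      also have "ennreal (1 - x) = emeasure lborel ({0<..<1} \<inter> {x<..})"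
      proof -
        have "{0<..<1} \<inter> {x<..} = {x<..<1}" using 2 by auto
        then show ?thesis using 2 by simp
      qed
      finally show ?thesis .
    next
      case 3
      then have "E \<inter> {x<..} = {}" "{0<..<1::real} \<inter> {x<..} = {}" using E(2) by (auto simp: irr_def)
      then show ?thesis by simp
    qed
  qed
  have [measurable]: "E \<in> sets borel" by fact
  have "density lborel (indicator E) = density lborel (\<lambda>x. ennreal p * indicator {0<..<1::real} x)"
  proof (rule measure_eqI_lessThan)
    fix x
    have 1: "emeasure (density lborel (indicator E)) {x<..} = emeasure lborel (E \<inter> {x<..})"
      by (simp add: emeasure_density indicator_inter_arith[symmetric])
    have 2: "emeasure (density lborel (\<lambda>x. ennreal p * indicator {0<..<1::real} x)) {x<..} = p * emeasure lborel ({0<..<1} \<inter> {x<..})"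
      by (simp add: emeasure_density mult.assoc indicator_inter_arith[symmetric] nn_integral_cmult)
    show "emeasure (density lborel (indicator E)) {x<..} < \<infinity>" unfolding 1 by (rule fin)
    show "emeasure (density lborel (indicator E)) {x<..} = emeasure (density lborel (\<lambda>x. ennreal p * indicator {0<..<1::real} x)) {x<..}"
      unfolding 1 2 by (rule tail)
  qed auto
  then have "emeasure (density lborel (indicator E)) E = emeasure (density lborel (\<lambda>x. ennreal p * indicator {0<..<1::real} x)) E"
    by simp
  moreover have "emeasure (density lborel (indicator E)) E = ennreal p"
    by (simp add: emeasure_density indicator_inter_arith[symmetric] Ep)
  moreover have "emeasure (density lborel (\<lambda>x. ennreal p * indicator {0<..<1::real} x)) E = ennreal (p * p)"
  proof -
    have "{0<..<1} \<inter> E = E" using E(2) by (auto simp: irr_def)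
    then show ?thesis using p0
      by (simp add: emeasure_density mult.assoc indicator_inter_arith[symmetric] nn_integral_cmult Ep ennreal_mult)
  qed
  ultimately have "ennreal p = ennreal (p * p)" by metis
  then have "p = p * p" using p0 ennreal_inj[of p "p * p"] mult_nonneg_nonneg[OF p0 p0] by blast
  then have "p * (p - 1) = 0" unfolding right_diff_distrib by linarith
  then consider "p = 0" | "p = 1" by fastforce
  then show ?thesis
  proof cases
    case 1 then show ?thesis using Ep by simp
  next
    case 2
    have "emeasure lborel (irr - E) = emeasure lborel irr - emeasure lborel E"
      using E fin[of UNIV] by (intro emeasure_Diff) auto
    also have "emeasure lborel irr = 1" unfolding irr_def by (subst emeasure_diff_Rats) auto
    finally show ?thesis using Ep 2 by simp
  qed
qed

section \<open>Ergodic properties of the tower\<close>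

abbreviation tower_measure :: "real measure" where
  "tower_measure \<equiv> restrict_space lborel tower"

lemma space_tower_measure: "space tower_measure = tower"
  by (simp add: space_restrict_space)

lemma sets_tower_measure_iff: "E \<in> sets tower_measure \<longleftrightarrow> E \<in> sets borel \<and> E \<subseteq> tower"
  using sets_restrict_space_iff[of tower lborel E] by auto

lemma emeasure_tower_measure: "E \<subseteq> tower \<Longrightarrow> emeasure tower_measure E = emeasure lborel E"
  by (intro emeasure_restrict_space) auto

lemma measurable_tower_measure:
  assumes "T \<in> borel_measurable borel" "\<And>x. x \<in> tower \<Longrightarrow> T x \<in> tower"
  shows "T \<in> tower_measure \<rightarrow>\<^sub>M tower_measure"
  using assms by (intro measurable_restrict_space2 measurable_restrict_space1) (auto simp: space_restrict_space)

lemma inverse_map_climb: "x \<in> tower \<Longrightarrow> inverse_map tower_measure climb x = climb_inv x"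
  unfolding inverse_map_def space_tower_measure
  using bij_betw_climb by (intro the_inv_into_f_eq) (auto simp: bij_betw_def climb_climb_inv climb_inv_in_tower)

lemma inverse_map_climb_pow:
  "x \<in> tower \<Longrightarrow> (inverse_map tower_measure climb ^^ n) x = (climb_inv ^^ n) x"
  by (induction n) (auto simp: inverse_map_climb climb_inv_pow_in_tower)

text \<open>E is covered by countably many translates of its slices, one for each level.\<close>

lemma emeasure_tower_zeroI:
  assumes E: "E \<in> sets borel" "E \<subseteq> tower"
    and slices: "\<And>i. emeasure lborel {y \<in> irr. y + real i \<in> E} = 0"
  shows "emeasure lborel E = 0"
proof -
  have [measurable]: "E \<in> sets borel" by fact
  define A where "A i = {x. x - real i \<in> {y \<in> irr. y + real i \<in> E}}" for i
  have [measurable]: "{y \<in> irr. y + real i \<in> E} \<in> sets borel" for i by measurable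
  have "A i \<in> null_sets lborel" for i
  proof
    show "emeasure lborel (A i) = 0" unfolding A_def by (subst emeasure_lborel_translate) (auto simp: slices)
    show "A i \<in> sets lborel" unfolding A_def by measurable
  qed
  then have "(\<Union>i. A i) \<in> null_sets lborel" by blast
  moreover have "E \<subseteq> (\<Union>i. A i)"
  proof
    fix x assume "x \<in> E"
    moreover from this obtain y i where "x = y + real i" "y \<in> irr" using E(2) tower_cases[of x] by blast
    ultimately show "x \<in> (\<Union>i. A i)" by (auto simp: A_def intro!: exI[of _ i])
  qed
  ultimately have "E \<in> null_sets lborel" using E(1) by (auto intro: null_sets_subset)
  then show ?thesis by auto
qed

text \<open>By invariance a point of a column lies in E exactly when its base point does, so every
  slice sits inside \<open>E \<inter> irr\<close>.\<close>

lemma emeasure_invariant_zeroI: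
  assumes E: "E \<in> sets borel" "E \<subseteq> tower" and inv: "\<And>x. x \<in> tower \<Longrightarrow> climb x \<in> E \<longleftrightarrow> x \<in> E"
    and zero: "emeasure lborel (E \<inter> irr) = 0"
  shows "emeasure lborel E = 0"
proof (rule emeasure_tower_zeroI[OF E])
  fix i
  have "{y \<in> irr. y + real i \<in> E} \<subseteq> E \<inter> irr"
  proof safe
    fix y assume y: "y \<in> irr" "y + real i \<in> E"
    have "y + real k \<in> E \<longleftrightarrow> y \<in> E" if "k \<le> i" for k
      using that
    proof (induction k)
      case (Suc k)
      have "i < height (lead y)" using y E(2) tower_add_nat by auto
      then have "y + real k \<in> tower" "climb (y + real k) = y + real (Suc k)"
        using Suc.prems y by (auto simp: tower_add_nat climb_add_nat)
      then show ?case using inv[of "y + real k"] Suc by simp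
    qed simp
    then show "y \<in> E" using y by blast
  qed
  then have "emeasure lborel {y \<in> irr. y + real i \<in> E} \<le> emeasure lborel (E \<inter> irr)"
    using E(1) by (intro emeasure_mono) auto
  then show "emeasure lborel {y \<in> irr. y + real i \<in> E} = 0" using zero by simp
qed

text \<open>The trace \<open>E \<inter> irr\<close> inherits dyadic invariance because orbits of
  \<open>climb\<close> pass through the dyadic translates. The dichotomy on the base is then lifted
  to the tower, for E or for its complement.\<close>

lemma ergodic_climb: "ergodic_map tower_measure climb"
  unfolding ergodic_map_def space_tower_measure
proof (intro ballI impI)
  fix E assume "E \<in> sets tower_measure" and eq: "climb -` E \<inter> tower = E"
  then have E: "E \<in> sets borel" "E \<subseteq> tower" by (auto simp: sets_tower_measure_iff)
  have inv: "climb x \<in> E \<longleftrightarrow> x \<in> E" if "x \<in> tower" for x using eq that by blast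
  have inv_pow: "(climb ^^ m) x \<in> E \<longleftrightarrow> x \<in> E" if "x \<in> tower" for x m
    by (induction m) (auto simp: inv that climb_pow_in_tower)
  have "emeasure lborel (E \<inter> irr) = 0 \<or> emeasure lborel (irr - E \<inter> irr) = 0"
  proof (rule dyadic_invariant_trivial)
    fix n k :: nat and x :: real assume *: "x \<in> irr" "x < 1 / 2^n" "k < 2^n"
    obtain m where m: "(odo ^^ m) x = x + real k / 2^n" using odo_orbit_dyadic[OF *] by blast
    then have "x + real k / 2^n \<in> irr" using odo_pow_irr[OF *(1), of m] by simp
    moreover have "x + real k / 2^n \<in> E \<longleftrightarrow> x \<in> E"
      using climb_orbit_dyadic[OF *] inv_pow[of x] *(1) irr_subset_tower by (metis subsetD)
    ultimately show "x + real k / 2^n \<in> E \<inter> irr \<longleftrightarrow> x \<in> E \<inter> irr" using * by blast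
  qed (use E in auto)
  then show "emeasure tower_measure E = 0 \<or> emeasure tower_measure (tower - E) = 0"
  proof
    assume "emeasure lborel (E \<inter> irr) = 0"
    then show ?thesis using emeasure_invariant_zeroI[OF E inv] E by (simp add: emeasure_tower_measure)
  next
    assume "emeasure lborel (irr - E \<inter> irr) = 0"
    moreover have "(tower - E) \<inter> irr = irr - E \<inter> irr" using irr_subset_tower by blast
    ultimately have zero: "emeasure lborel ((tower - E) \<inter> irr) = 0" by simp
    have "emeasure lborel (tower - E) = 0"
    proof (rule emeasure_invariant_zeroI[OF _ _ _ zero])
      show "tower - E \<in> sets borel" using E by auto
      fix x assume "x \<in> tower"
      then show "climb x \<in> tower - E \<longleftrightarrow> x \<in> tower - E" using inv[of x] climb_in_tower[of x] by blast
    qed blast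
    then show ?thesis by (simp add: emeasure_tower_measure)
  qed
qed

text \<open>A set meeting every forward orbit at most once has disjoint dyadic translates inside
  an interval of length \<open>1 / 2^n\<close>, for every \<open>n\<close>.\<close>

lemma emeasure_wandering_slice:
  assumes V: "V \<in> sets borel" "V \<subseteq> irr"
    and once: "\<And>x m m'. x \<in> irr \<Longrightarrow> (climb ^^ m) x \<in> V \<Longrightarrow> (climb ^^ m') x \<in> V \<Longrightarrow> m = m'"
  shows "emeasure lborel V = 0"
proof -
  have [measurable]: "V \<in> sets borel" by fact
  have le: "emeasure lborel V \<le> ennreal (1 / 2^n)" for n
  proof -
    define P where "P k = V \<inter> {real k / 2^n<..<real (Suc k) / 2^n}" for k
    \<comment> \<open>\<open>Q k\<close> is \<open>P k\<close> moved down into the first dyadic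
      interval; the double minus matches \<open>emeasure_lborel_translate\<close>.\<close>
    define Q where "Q k = {x. x - (- (real k / 2^n)) \<in> P k}" for k
    have [measurable]: "P k \<in> sets borel" for k unfolding P_def by measurable
    have [measurable]: "Q k \<in> sets borel" for k unfolding Q_def by measurable
    have sub: "Q k \<subseteq> irr \<inter> {0<..<1 / 2^n}" for k
    proof
      fix x assume "x \<in> Q k"
      then have x: "x + real k / 2^n \<in> irr" "real k / 2^n < x + real k / 2^n" "x + real k / 2^n < real (Suc k) / 2^n"
        using V(2) by (auto simp: Q_def P_def)
      have "x \<notin> \<rat>" using irrD(3)[OF x(1)] add_Rats_iff[of "real k / 2^n" x] by auto
      moreover have x2: "0 < x" "x < 1 / 2^n" using x(2,3) by (auto simp: add_divide_distrib)
      moreover have "x < 1" using x2(2) by (rule less_le_trans) simp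
      ultimately show "x \<in> irr \<inter> {0<..<1 / 2^n}" by (auto simp: irr_def)
    qed
    \<comment> \<open>The orbit of a common point x would meet V at both x + k / 2^n and x + l /
      2^n; by \<open>once\<close> the two times agree, hence k = l.\<close>
    have disj: "disjoint_family_on Q {..<2^n}"
      unfolding disjoint_family_on_def
    proof (intro ballI impI equals0I)
      fix k l x assume kl: "k \<in> {..<2^n}" "l \<in> {..<2^n}" "k \<noteq> l" and x: "x \<in> Q k \<inter> Q l"
      then have xi: "x \<in> irr" "x < 1 / 2^n" using sub[of k] by auto
      obtain m where m: "(climb ^^ m) x = x + real k / 2^n" using climb_orbit_dyadic[OF xi] kl(1) by blast
      obtain m' where m': "(climb ^^ m') x = x + real l / 2^n" using climb_orbit_dyadic[OF xi] kl(2) by blast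
      have "m = m'" using m m' x xi by (intro once[of x]) (auto simp: Q_def P_def)
      then show False using m m' kl by (auto simp: field_simps)
    qed
    have cover: "V \<subseteq> (\<Union>k<2^n. P k)"
    proof
      fix x assume x: "x \<in> V"
      then have xi: "0 < x" "x < 1" "x \<notin> \<rat>" using V(2) irrD by auto
      define k where "k = nat \<lfloor>x * 2^n\<rfloor>"
      have "real k = real_of_int \<lfloor>x * 2^n\<rfloor>" using xi unfolding k_def by simp
      then have k: "real k \<le> x * 2^n" "x * 2^n < real (Suc k)" by linarith+
      moreover have "x * 2^n < 1 * 2^n" using xi by (intro mult_strict_right_mono) auto
      ultimately have "real k < 2^n" by linarith
      moreover have "x \<noteq> real k / 2^n" using xi(3) by auto
      moreover have "real k / 2^n \<le> x" "x < real (Suc k) / 2^n" using k by (auto simp: field_simps)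
      ultimately have "k < 2^n" "x \<in> P k" using x by (auto simp: P_def)
      then show "x \<in> (\<Union>k<2^n. P k)" by blast
    qed
    have "emeasure lborel V \<le> emeasure lborel (\<Union>k<2^n. P k)" by (intro emeasure_mono cover) auto
    also have "\<dots> \<le> (\<Sum>k<2^n. emeasure lborel (P k))" by (intro emeasure_subadditive_finite) auto
    also have "\<dots> = (\<Sum>k<2^n. emeasure lborel (Q k))"
      unfolding Q_def by (intro sum.cong refl emeasure_lborel_translate[symmetric]) auto
    also have "\<dots> = emeasure lborel (\<Union>k<2^n. Q k)" by (intro sum_emeasure disj) auto
    also have "\<dots> \<le> emeasure lborel {0<..<1 / 2^n::real}" using sub by (intro emeasure_mono) auto
    also have "\<dots> = ennreal (1 / 2^n)" by simp
    finally show ?thesis .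
  qed
  have "(\<lambda>n. ennreal (1 / 2^n)) \<longlonglongrightarrow> ennreal 0" by (intro tendsto_ennrealI) real_asymp
  then have "emeasure lborel V \<le> ennreal 0" by (rule LIMSEQ_le_const) (use le in auto)
  then show ?thesis by simp
qed

text \<open>An orbit that is in the slice of level i at time m is in W at time i + m. Disjoint
  preimages of W thus let every orbit meet each slice at most once, so all slices are null.\<close>

lemma conservative_climb: "conservative_map tower_measure climb"
  unfolding conservative_map_def space_tower_measure
proof (intro notI, elim bexE conjE)
  fix W assume W: "W \<in> sets tower_measure" "0 < emeasure tower_measure W"
    and disj: "disjoint_family (\<lambda>n. (climb ^^ n) -` W \<inter> tower)"
  then have Wb: "W \<in> sets borel" "W \<subseteq> tower" by (auto simp: sets_tower_measure_iff)
  have "emeasure lborel W = 0"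
  proof (rule emeasure_tower_zeroI[OF Wb])
    fix i
    let ?V = "{y \<in> irr. y + real i \<in> W}"
    show "emeasure lborel ?V = 0"
    proof (rule emeasure_wandering_slice)
      have [measurable]: "W \<in> sets borel" by fact
      show "?V \<in> sets borel" by measurable
      fix x m m' assume x: "x \<in> irr" and V: "(climb ^^ m) x \<in> ?V" "(climb ^^ m') x \<in> ?V"
      have up: "(climb ^^ i) y \<in> W" if "y \<in> ?V" for y
      proof -
        have "i < height (lead y)" using that Wb(2) tower_add_nat by auto
        then show ?thesis using that climb_pow_add_nat[of y 0 i] by simp
      qed
      have "(climb ^^ (i + m)) x \<in> W" "(climb ^^ (i + m')) x \<in> W" using up[OF V(1)] up[OF V(2)] by (simp_all add: funpow_add)
      moreover have "x \<in> tower" using x irr_subset_tower by blast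
      ultimately have "i + m = i + m'" using disjoint_family_onD[OF disj, of "i + m" "i + m'"] by blast
      then show "m = m'" by simp
    qed auto
  qed
  then show False using W Wb by (simp add: emeasure_tower_measure)
qed

lemma measure_preserving_climb: "measure_preserving_map tower_measure climb"
  unfolding measure_preserving_map_def space_tower_measure
proof
  fix E assume "E \<in> sets tower_measure"
  then have E: "E \<in> sets borel" "E \<subseteq> tower" by (auto simp: sets_tower_measure_iff)
  have "emeasure lborel (climb -` E \<inter> tower) = emeasure lborel E"
    using E by (intro emeasure_preserved_rational_translations bij_betw_climb climb_diff_Rats) auto
  then show "emeasure tower_measure (climb -` E \<inter> tower) = emeasure tower_measure E"
    using E by (simp add: emeasure_tower_measure)
qed

lemma invertible_climb: "invertible_map tower_measure climb"
  unfolding invertible_map_def space_tower_measure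
proof
  have "climb_inv \<in> tower_measure \<rightarrow>\<^sub>M tower_measure"
    by (intro measurable_tower_measure climb_inv_in_tower) auto
  \<comment> \<open>\<open>inverse_map\<close> is compared with \<open>climb_inv\<close> on the
    tower only; outside it \<open>the_inv_into\<close> is unspecified.\<close>
  then show "inverse_map tower_measure climb \<in> tower_measure \<rightarrow>\<^sub>M tower_measure"
    by (subst measurable_cong[of _ _ climb_inv]) (auto simp: inverse_map_climb space_tower_measure)
qed (rule bij_betw_climb)

theorem mainTheorem2:
  shows "\<exists>(M :: real measure) (T :: real \<Rightarrow> real) (f :: real \<Rightarrow> real).
     sigma_finite_measure M \<and> emeasure M (space M) = \<infinity> \<and>
     T \<in> M \<rightarrow>\<^sub>M M \<and> conservative_map M T \<and> invertible_map M T \<and>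
     measure_preserving_map M T \<and> ergodic_map M T \<and>
     f \<in> borel_measurable M \<and> f \<in> space M \<rightarrow> {0, 1} \<and>
     (\<forall>\<omega>\<in>space M.
        limsup (\<lambda>n. ereal (birkhoff_avg n \<omega> f T)) = 1 \<and>
        (\<lambda>n. birkhoff_avg n \<omega> f (inverse_map M T)) \<longlonglongrightarrow> 0)"
proof (rule exI[of _ tower_measure], rule exI[of _ climb], rule exI[of _ bottom], intro conjI ballI)
  show "sigma_finite_measure tower_measure"
    by (intro sigma_finite_measure_restrict_space lborel.sigma_finite_measure_axioms) auto
  show "emeasure tower_measure (space tower_measure) = \<infinity>"
    using emeasure_lborel_tower by (simp add: space_tower_measure emeasure_tower_measure)
  show "climb \<in> tower_measure \<rightarrow>\<^sub>M tower_measure"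
    by (intro measurable_tower_measure climb_in_tower) auto
  show "bottom \<in> borel_measurable tower_measure"
    by (intro measurable_restrict_space1) auto
  show "bottom \<in> space tower_measure \<rightarrow> {0, 1}"
    by (auto simp: bottom_def)
  fix x assume "x \<in> space tower_measure"
  then have x: "x \<in> tower" by (simp add: space_tower_measure)
  show "limsup (\<lambda>n. ereal (birkhoff_avg n x bottom climb)) = 1"
    using birkhoff_avg_climb_large[OF x] by (intro limsup_birkhoff_avg_eq_1I) (auto simp: bottom_def)
  show "(\<lambda>n. birkhoff_avg n x bottom (inverse_map tower_measure climb)) \<longlonglongrightarrow> 0"
    using birkhoff_avg_climb_inv_tendsto[OF x] by (simp add: birkhoff_avg_def inverse_map_climb_pow x)
qed (rule conservative_climb invertible_climb measure_preserving_climb ergodic_climb)+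

end
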